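(* Let $\epsilon\in\{1,-1\}$ and let $\boldsymbol A\cdot\boldsymbol B=A_0B_0+\epsilon(A_1B_1+A_2B_2)$ on $\mathbb R^3$. Let $U,V:\mathbb Z\to\mathbb R$ satisfy $U(m_1)+V(m_2)>0$ for all $(m_1,m_2)\in\mathbb Z^2$. Let $\boldsymbol N:\mathbb Z^2\to\mathbb R^3$ be a solution of the discrete Bianchi--Ernst system with data $(U,V)$, that is, for some $F:\mathbb Z^2\to\mathbb R$, $$\boldsymbol N_{(12)}+\boldsymbol N=F(\boldsymbol N_{(1)}+\boldsymbol N_{(2)}),\qquad (\boldsymbol N_{(12)}+\boldsymbol N)\cdot(\boldsymbol N_{(1)}+\boldsymbol N_{(2)})=U(m_1)+V(m_2).$$ Put $\boldsymbol n_0:=\boldsymbol N_{(12)}+\boldsymbol N$, assume $\boldsymbol n_0\cdot\boldsymbol n_0>0$ everywhere, and let $\boldsymbol n_1,\boldsymbol n_2:\mathbb Z^2\to\mathbb R^3$ satisfy $\boldsymbol n_1\cdot\boldsymbol n_1=\boldsymbol n_2\cdot\boldsymbol n_2=\epsilon$, and be orthogonal to $\boldsymbol n_0$ and to each other at every point. Fix a choice of sign (upper or lower throughout) and a constant $k\in\mathbb R$ such that $$Y:=U(m_1)+V(m_2),\qquad a:=U(m_1)\mp k,\qquad b:=V(m_2)\pm k$$ have $a$ and $b$ nowhere zero. Let $p_A^B,q_A^B:\mathbb Z^2\to\mathbb R$ ($A,B\in\{0,1,2\}$) be defined by $\boldsymbol n_A=p_A^B\,\boldsymbol n_{B(1)}$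 and $\boldsymbol n_A=q_A^B\,\boldsymbol n_{B(2)}$. Consider the linear system for $\Psi=(\Theta,\Theta_{(1)},\Theta_{(2)},x^1,x^2)^T$ $$\Psi_{(1)}=M_1\Psi,\qquad \Psi_{(2)}=M_2\Psi,\qquad (\ast)$$ with $$M_1=\begin{pmatrix} 0&1&0&0&0\\ \frac{Y_{(1)}\frac{p_0^0}{F}-b}{a_{(1)}}&\frac{bF-Y_{(1)}\left(\frac{Y+b}{Y}p_0^0-\frac1{F_{(1)}}\right)}{a_{(1)}}&\frac{b}{a_{(1)}}\left(F-\frac{Y_{(1)}}{Y}p_0^0\right)&\mp\frac{Y_{(1)}}{a_{(1)}}p_1^0&\mp\frac{Y_{(1)}}{a_{(1)}}p_2^0\\ -1&F&F&0&0\\ \mp\frac{p_0^1}{F}&\pm\frac{Y+b}{Y}p_0^1&\pm\frac bYp_0^1&p_1^1&p_2^1\\ \mp\frac{p_0^2}{F}&\pm\frac{Y+b}{Y}p_0^2&\pm\frac bYp_0^2&p_1^2&p_2^2 \end{pmatrix},$$ $$M_2=\begin{pmatrix} 0&0&1&0&0\\ -1&F&F&0&0\\ \frac{Y_{(2)}\frac{q_0^0}{F}-a}{b_{(2)}}&\frac{a}{b_{(2)}}\left(F-\frac{Y_{(2)}}{Y}q_0^0\right)&\frac{aF-Y_{(2)}\left(\frac{Y+a}{Y}q_0^0-\frac1{F_{(2)}}\right)}{b_{(2)}}&\pm\frac{Y_{(2)}}{b_{(2)}}q_1^0&\pm\frac{Y_{(2)}}{b_{(2)}}q_2^0\\ \pm\frac{q_0^1}{F}&\mp\frac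 aYq_0^1&\mp\frac{a+Y}{Y}q_0^1&q_1^1&q_2^1\\ \pm\frac{q_0^2}{F}&\mp\frac aYq_0^2&\mp\frac{a+Y}{Y}q_0^2&q_1^2&q_2^2 \end{pmatrix}.$$ Then: 1. The linear system $(\ast)$ is compatible, i.e. $(M_2)_{(1)}M_1=(M_1)_{(2)}M_2$ on $\mathbb Z^2$. 2. A solution $(\Theta,\Theta_{(1)},\Theta_{(2)},x^1,x^2)$ of $(\ast)$ satisfies the constraint $$\epsilon\left[(x^1)^2+(x^2)^2\right]+\frac YF\Theta^2+FY\left(-\frac aY\Theta_{(1)}+\frac bY\Theta_{(2)}\right)^2-2\Theta\left(a\Theta_{(1)}+b\Theta_{(2)}\right)=0\qquad(\ast\ast)$$ at every point of $\mathbb Z^2$, provided that $(\ast\ast)$ is satisfied at the initial point. 3. If $(\Theta,\Theta_{(1)},\Theta_{(2)},x^1,x^2)$ is a solution of $(\ast)$ with $\Theta$ nowhere zero which satisfies $(\ast\ast)$, then $$\boldsymbol N':=\tfrac12\left(\pm\boldsymbol N_{(1)}\mp\boldsymbol N_{(2)}\right)+\frac{1}{2\Theta}\sum_{A=0}^2x^A\boldsymbol n_A,\qquad x^0:=\frac{\mp\Theta_{(1)}(U\mp k)\pm\Theta_{(2)}(V\pm k)}{U+V},$$ is a solution of the discrete Bianchi--Ernst system with the same data $(U,V)$, i.e. there is $F':\mathbb Z^2\to\mathbb R$ with $\boldsymbol N'_{(12)}+\boldsymbol N'=F'(\boldsymbol N'_{(1)}+\boldsymbol N'_{(2)})$, and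 $(\boldsymbol N'_{(12)}+\boldsymbol N')\cdot(\boldsymbol N'_{(1)}+\boldsymbol N'_{(2)})=U(m_1)+V(m_2)$.
   Context: For any function $g$ (scalar, vector or matrix valued) on $\mathbb Z^2$, subscripts in brackets denote shifts: $g_{(1)}(m_1,m_2)=g(m_1+1,m_2)$, $g_{(2)}(m_1,m_2)=g(m_1,m_2+1)$, $g_{(12)}(m_1,m_2)=g(m_1+1,m_2+1)$. $U$ is regarded as a function on $\mathbb Z^2$ depending only on $m_1$, and $V$ as one depending only on $m_2$. Repeated upper/lower indices $A,B\in\{0,1,2\}$ are summed. At each point $\{\boldsymbol n_0,\boldsymbol n_1,\boldsymbol n_2\}$ is a basis of $\mathbb R^3$ orthogonal for "$\cdot$", so $p_A^B,q_A^B$ are uniquely determined. Under the assumptions, $F=\dfrac{U(m_1)+V(m_2)}{(\boldsymbol N_{(1)}+\boldsymbol N_{(2)})\cdot(\boldsymbol N_{(1)}+\boldsymbol N_{(2)})}$. In $\pm,\mp$ one takes either all upper signs or all lower signs. The rows of $M_1,M_2$ are consistent with the second and third components of $\Psi$ being the shifts of the first. *)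

theory Defs
  imports "HOL-Analysis.Analysis"
begin

type_synonym 'a lattice_fun = "int \<Rightarrow> int \<Rightarrow> 'a"

definition shift1 :: "'a lattice_fun \<Rightarrow> 'a lattice_fun" where
  "shift1 g = (\<lambda>m1 m2. g (m1 + 1) m2)"

definition shift2 :: "'a lattice_fun \<Rightarrow> 'a lattice_fun" where
  "shift2 g = (\<lambda>m1 m2. g m1 (m2 + 1))"

definition shift12 :: "'a lattice_fun \<Rightarrow> 'a lattice_fun" where
  "shift12 g = (\<lambda>m1 m2. g (m1 + 1) (m2 + 1))"

text \<open>In the index type 3 the numeral 3 equals 0, so 0, 1, 2 are exactly its three elements;
  this holds both for components of vectors and for the frame indices below.\<close>

definition form :: "real \<Rightarrow> real ^ 3 \<Rightarrow> real ^ 3 \<Rightarrow> real" where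
  "form \<epsilon> A B = A $ 0 * B $ 0 + \<epsilon> * (A $ 1 * B $ 1 + A $ 2 * B $ 2)"

definition bianchi_ernst_with ::
  "real \<Rightarrow> (int \<Rightarrow> real) \<Rightarrow> (int \<Rightarrow> real) \<Rightarrow> (real ^ 3) lattice_fun \<Rightarrow> real lattice_fun \<Rightarrow> bool"
  where
  "bianchi_ernst_with \<epsilon> U V N F \<longleftrightarrow>
     (\<forall>m1 m2. shift12 N m1 m2 + N m1 m2 = F m1 m2 *\<^sub>R (shift1 N m1 m2 + shift2 N m1 m2)) \<and>
     (\<forall>m1 m2. form \<epsilon> (shift12 N m1 m2 + N m1 m2) (shift1 N m1 m2 + shift2 N m1 m2)
                = U m1 + V m2)"

definition bianchi_ernst_solution ::
  "real \<Rightarrow> (int \<Rightarrow> real) \<Rightarrow> (int \<Rightarrow> real) \<Rightarrow> (real ^ 3) lattice_fun \<Rightarrow> bool" where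
  "bianchi_ernst_solution \<epsilon> U V N \<longleftrightarrow> (\<exists>F. bianchi_ernst_with \<epsilon> U V N F)"

text \<open>The double signs are encoded by a real \<open>s\<close>: \<open>s = 1\<close> selects all upper signs and
  \<open>s = - 1\<close> all lower ones, so that plus-minus becomes \<open>s\<close> and minus-plus becomes \<open>- s\<close>.\<close>

definition Y_of :: "(int \<Rightarrow> real) \<Rightarrow> (int \<Rightarrow> real) \<Rightarrow> real lattice_fun" where
  "Y_of U V = (\<lambda>m1 m2. U m1 + V m2)"

definition a_of :: "real \<Rightarrow> real \<Rightarrow> (int \<Rightarrow> real) \<Rightarrow> real lattice_fun" where
  "a_of s k U = (\<lambda>m1 m2. U m1 - s * k)"

definition b_of :: "real \<Rightarrow> real \<Rightarrow> (int \<Rightarrow> real) \<Rightarrow> real lattice_fun" where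
  "b_of s k V = (\<lambda>m1 m2. V m2 + s * k)"

text \<open>The coefficient with lower index \<open>A\<close> and upper index \<open>B\<close> is \<open>p A B\<close> (resp. \<open>q A B\<close>).\<close>

definition M1 ::
  "real \<Rightarrow> real \<Rightarrow> (int \<Rightarrow> real) \<Rightarrow> (int \<Rightarrow> real) \<Rightarrow> real lattice_fun \<Rightarrow>
   (3 \<Rightarrow> 3 \<Rightarrow> real lattice_fun) \<Rightarrow> (real ^ 5 ^ 5) lattice_fun" where
  "M1 s k U V F p = (\<lambda>m1 m2.
     let Y = Y_of U V m1 m2; Y1 = shift1 (Y_of U V) m1 m2;
         a1 = shift1 (a_of s k U) m1 m2; b = b_of s k V m1 m2;
         f = F m1 m2; f1 = shift1 F m1 m2;
         P = (\<lambda>A B. p A B m1 m2)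
     in vector [
       vector [0, 1, 0, 0, 0],
       vector [(Y1 * (P 0 0 / f) - b) / a1,
               (b * f - Y1 * ((Y + b) / Y * P 0 0 - 1 / f1)) / a1,
               b / a1 * (f - Y1 / Y * P 0 0),
               - s * (Y1 / a1) * P 1 0,
               - s * (Y1 / a1) * P 2 0],
       vector [-1, f, f, 0, 0],
       vector [- s * (P 0 1 / f), s * ((Y + b) / Y) * P 0 1, s * (b / Y) * P 0 1, P 1 1, P 2 1],
       vector [- s * (P 0 2 / f), s * ((Y + b) / Y) * P 0 2, s * (b / Y) * P 0 2, P 1 2, P 2 2]])"

definition M2 ::
  "real \<Rightarrow> real \<Rightarrow> (int \<Rightarrow> real) \<Rightarrow> (int \<Rightarrow> real) \<Rightarrow> real lattice_fun \<Rightarrow>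
   (3 \<Rightarrow> 3 \<Rightarrow> real lattice_fun) \<Rightarrow> (real ^ 5 ^ 5) lattice_fun" where
  "M2 s k U V F q = (\<lambda>m1 m2.
     let Y = Y_of U V m1 m2; Y2 = shift2 (Y_of U V) m1 m2;
         a = a_of s k U m1 m2; b2 = shift2 (b_of s k V) m1 m2;
         f = F m1 m2; f2 = shift2 F m1 m2;
         Q = (\<lambda>A B. q A B m1 m2)
     in vector [
       vector [0, 0, 1, 0, 0],
       vector [-1, f, f, 0, 0],
       vector [(Y2 * (Q 0 0 / f) - a) / b2,
               a / b2 * (f - Y2 / Y * Q 0 0),
               (a * f - Y2 * ((Y + a) / Y * Q 0 0 - 1 / f2)) / b2,
               s * (Y2 / b2) * Q 1 0,
               s * (Y2 / b2) * Q 2 0],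
       vector [s * (Q 0 1 / f), - s * (a / Y) * Q 0 1, - s * ((a + Y) / Y) * Q 0 1, Q 1 1, Q 2 1],
       vector [s * (Q 0 2 / f), - s * (a / Y) * Q 0 2, - s * ((a + Y) / Y) * Q 0 2, Q 1 2, Q 2 2]])"

definition Psi ::
  "real lattice_fun \<Rightarrow> real lattice_fun \<Rightarrow> real lattice_fun \<Rightarrow> (real ^ 5) lattice_fun" where
  "Psi \<Theta> x1 x2 = (\<lambda>m1 m2.
     vector [\<Theta> m1 m2, shift1 \<Theta> m1 m2, shift2 \<Theta> m1 m2, x1 m1 m2, x2 m1 m2])"

definition solves_linear_system ::
  "(real ^ 5 ^ 5) lattice_fun \<Rightarrow> (real ^ 5 ^ 5) lattice_fun \<Rightarrow> (real ^ 5) lattice_fun \<Rightarrow> bool" where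
  "solves_linear_system A B \<Psi> \<longleftrightarrow>
     (\<forall>m1 m2. shift1 \<Psi> m1 m2 = A m1 m2 *v \<Psi> m1 m2 \<and> shift2 \<Psi> m1 m2 = B m1 m2 *v \<Psi> m1 m2)"

definition compatible_system ::
  "(real ^ 5 ^ 5) lattice_fun \<Rightarrow> (real ^ 5 ^ 5) lattice_fun \<Rightarrow> bool" where
  "compatible_system A B \<longleftrightarrow>
     (\<forall>m1 m2. shift1 B m1 m2 ** A m1 m2 = shift2 A m1 m2 ** B m1 m2)"

definition constraint_at ::
  "real \<Rightarrow> real \<Rightarrow> real \<Rightarrow> (int \<Rightarrow> real) \<Rightarrow> (int \<Rightarrow> real) \<Rightarrow> real lattice_fun \<Rightarrow>
   real lattice_fun \<Rightarrow> real lattice_fun \<Rightarrow> real lattice_fun \<Rightarrow> int \<Rightarrow> int \<Rightarrow> bool" where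
  "constraint_at \<epsilon> s k U V F \<Theta> x1 x2 m1 m2 \<longleftrightarrow>
     (let Y = Y_of U V m1 m2; a = a_of s k U m1 m2; b = b_of s k V m1 m2; f = F m1 m2;
          \<theta> = \<Theta> m1 m2; \<theta>1 = shift1 \<Theta> m1 m2; \<theta>2 = shift2 \<Theta> m1 m2
      in \<epsilon> * ((x1 m1 m2)\<^sup>2 + (x2 m1 m2)\<^sup>2) + Y / f * \<theta>\<^sup>2
           + f * Y * (- (a / Y) * \<theta>1 + b / Y * \<theta>2)\<^sup>2
           - 2 * \<theta> * (a * \<theta>1 + b * \<theta>2) = 0)"

definition x0_of ::
  "real \<Rightarrow> real \<Rightarrow> (int \<Rightarrow> real) \<Rightarrow> (int \<Rightarrow> real) \<Rightarrow> real lattice_fun \<Rightarrow> real lattice_fun" where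
  "x0_of s k U V \<Theta> = (\<lambda>m1 m2.
     (- s * shift1 \<Theta> m1 m2 * (U m1 - s * k) + s * shift2 \<Theta> m1 m2 * (V m2 + s * k))
       / (U m1 + V m2))"

definition transformed ::
  "real \<Rightarrow> real \<Rightarrow> (int \<Rightarrow> real) \<Rightarrow> (int \<Rightarrow> real) \<Rightarrow> (real ^ 3) lattice_fun \<Rightarrow>
   (3 \<Rightarrow> (real ^ 3) lattice_fun) \<Rightarrow> real lattice_fun \<Rightarrow> real lattice_fun \<Rightarrow> real lattice_fun \<Rightarrow>
   (real ^ 3) lattice_fun" where
  "transformed s k U V N n \<Theta> x1 x2 = (\<lambda>m1 m2.
     (1 / 2) *\<^sub>R (s *\<^sub>R shift1 N m1 m2 - s *\<^sub>R shift2 N m1 m2)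
     + (1 / (2 * \<Theta> m1 m2)) *\<^sub>R
         (x0_of s k U V \<Theta> m1 m2 *\<^sub>R n 0 m1 m2 + x1 m1 m2 *\<^sub>R n 1 m1 m2 + x2 m1 m2 *\<^sub>R n 2 m1 m2))"

end

theory Submission
  imports Defs
begin

text \<open>Write \<open>X = x\<^sup>A n\<^sub>A\<close> and \<open>m = N\<^sub>1 + N\<^sub>2\<close>, so that \<open>n\<^sub>0 = F m\<close>. The linear system says that \<open>\<Theta>\<close> solves
  the wave equation \<open>\<Theta>\<^sub>1\<^sub>2 + \<Theta> = F (\<Theta>\<^sub>1 + \<Theta>\<^sub>2)\<close>, that \<open>X \<cdot> m = s (b \<Theta>\<^sub>2 - a \<Theta>\<^sub>1)\<close>, and that
  \<open>X\<^sub>1 = X + s (2 \<Theta>\<^sub>1 n\<^sub>0 - \<Theta> m - \<Theta>\<^sub>1 m\<^sub>1)\<close>, with the same relation for the other direction and \<open>s\<close>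
  replaced by \<open>- s\<close>. In this frame-free form compatibility reduces to
  \<open>m + m\<^sub>1\<^sub>2 = n\<^sub>0\<^sub>1 + n\<^sub>0\<^sub>2\<close>, the left-hand side of the constraint is unchanged by both shifts, and \<open>N'\<close>
  is the Moutard transform \<open>\<Theta>\<^sub>1 (N'\<^sub>1 - s N) = \<Theta> (N' - s N\<^sub>1)\<close>, \<open>\<Theta>\<^sub>2 (N'\<^sub>2 + s N) = \<Theta> (N' + s N\<^sub>2)\<close>;
  the constraint gives the normalisation of its inner product.\<close>

section \<open>Vectors of length five and sums over the index types 3 and 5\<close>

lemma exhaust_5:
  fixes x :: 5
  shows "x = 1 \<or> x = 2 \<or> x = 3 \<or> x = 4 \<or> x = 5"
proof (induct x)
  case (of_int z)
  then have "z = 0 \<or> z = 1 \<or> z = 2 \<or> z = 3 \<or> z = 4" by fastforce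
  then show ?case by auto
qed

lemma UNIV_5: "UNIV = {1, 2, 3, 4, 5::5}"
  using exhaust_5 by auto

lemma sum_5: "sum f (UNIV::5 set) = f 1 + f 2 + f 3 + f 4 + f 5"
  unfolding UNIV_5 by (simp add: ac_simps)

lemma vector_5 [simp]:
  "(vector [v, w, x, y, z] :: 'a::zero ^ 5) $ 1 = v"
  "(vector [v, w, x, y, z] :: 'a::zero ^ 5) $ 2 = w"
  "(vector [v, w, x, y, z] :: 'a::zero ^ 5) $ 3 = x"
  "(vector [v, w, x, y, z] :: 'a::zero ^ 5) $ 4 = y"
  "(vector [v, w, x, y, z] :: 'a::zero ^ 5) $ 5 = z"
  unfolding vector_def by simp_all

lemma vec_eq_iff_5: "x = y \<longleftrightarrow> x$1 = y$1 \<and> x$2 = y$2 \<and> x$3 = y$3 \<and> x$4 = y$4 \<and> x$5 = y$5"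
  for x y :: "'a ^ 5"
  unfolding vec_eq_iff by (metis exhaust_5)

lemma sum_UNIV_3: "sum f (UNIV::3 set) = f 0 + f 1 + f 2"
proof -
  \<comment> \<open>\<open>sum_3\<close> runs over 1, 2, 3, whereas the frame indices are 0, 1,
    2.\<close>
  have "(3::3) = 0" by simp
  then show ?thesis by (simp only: sum_3 ac_simps)
qed

lemma int_periodic_1_imp_const:
  fixes g :: "int \<Rightarrow> 'a"
  assumes "\<And>i. g (i + 1) = g i"
  shows "g i = g j"
proof (induction i rule: int_induct[where k = j])
  case (step2 i)
  then show ?case using assms[of "i - 1"] by simp
qed (simp_all add: assms)

section \<open>The bilinear form and the algebra of a single lattice step\<close>

lemma form_commute: "form \<epsilon> x y = form \<epsilon> y x"
  by (simp add: form_def mult.commute)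

lemma form_linear [simp]:
  "form \<epsilon> (x + y) z = form \<epsilon> x z + form \<epsilon> y z"
  "form \<epsilon> z (x + y) = form \<epsilon> z x + form \<epsilon> z y"
  "form \<epsilon> (x - y) z = form \<epsilon> x z - form \<epsilon> y z"
  "form \<epsilon> z (x - y) = form \<epsilon> z x - form \<epsilon> z y"
  "form \<epsilon> (c *\<^sub>R x) z = c * form \<epsilon> x z"
  "form \<epsilon> z (c *\<^sub>R x) = c * form \<epsilon> z x"
  by (simp_all add: form_def algebra_simps)

text \<open>The first three terms on the right, together with the \<open>n0\<close> correction, are
  expanded in the shifted frame. The components along \<open>n1'\<close> and \<open>n2'\<close> are
  the last two rows of the matrix, and the component along \<open>n0'\<close> is its second row
  solved for \<open>t11\<close>. With free scalars the lemma serves both directions: the second one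
  exchanges \<open>a\<close> with \<open>b\<close> and \<open>t1\<close> with \<open>t2\<close>, and
  replaces \<open>s\<close> by \<open>- s\<close>.\<close>

lemma frame_shift:
  fixes n0 n1 n2 n0' n1' n2' :: "'v::real_vector"
  assumes n: "n0 = p00 *\<^sub>R n0' + p01 *\<^sub>R n1' + p02 *\<^sub>R n2'"
      "n1 = p10 *\<^sub>R n0' + p11 *\<^sub>R n1' + p12 *\<^sub>R n2'"
      "n2 = p20 *\<^sub>R n0' + p21 *\<^sub>R n1' + p22 *\<^sub>R n2'"
    and s: "s * s = 1" and nz: "a1 \<noteq> 0" "Y \<noteq> 0" "Y1 \<noteq> 0" "f \<noteq> 0" "f1 \<noteq> 0"
    and Y: "Y = a + b"
    and t11: "t11 = (Y1 * (p00 / f) - b) / a1 * t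
        + (b * f - Y1 * ((Y + b) / Y * p00 - 1 / f1)) / a1 * t1
        + b / a1 * (f - Y1 / Y * p00) * t2 - s * (Y1 / a1) * p10 * x1 - s * (Y1 / a1) * p20 * x2"
    and t12: "t12 = f * t1 + f * t2 - t"
    and y1: "y1 = - s * (p01 / f) * t + s * ((Y + b) / Y) * p01 * t1 + s * (b / Y) * p01 * t2
        + p11 * x1 + p21 * x2"
    and y2: "y2 = - s * (p02 / f) * t + s * ((Y + b) / Y) * p02 * t1 + s * (b / Y) * p02 * t2
        + p12 * x1 + p22 * x2"
  shows "(s * (b * t12 - a1 * t11) / Y1) *\<^sub>R n0' + y1 *\<^sub>R n1' + y2 *\<^sub>R n2'
    = (s * (b * t2 - a * t1) / Y) *\<^sub>R n0 + x1 *\<^sub>R n1 + x2 *\<^sub>R n2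
      + (s * (2 * t1 - t / f)) *\<^sub>R n0 - (s * t1 / f1) *\<^sub>R n0'"
proof -
  define x0 where "x0 = s * (b * t2 - a * t1) / Y"
  define c where "c = s * (2 * t1 - t / f)"
  have a: "a = Y - b"
    by (simp add: Y)
  \<comment> \<open>Since 2 - a/Y = (Y + b)/Y, this is where the matrix entries containing Y + b
    come from.\<close>
  have x0c: "x0 + c = s * ((Y + b) / Y * t1 + b / Y * t2 - t / f)"
    unfolding x0_def c_def a using nz by (simp add: field_simps)
  have "a1 * t11 = (Y1 * (p00 / f) - b) * t
      + (b * f - Y1 * ((Y + b) / Y * p00 - 1 / f1)) * t1
      + b * (f - Y1 / Y * p00) * t2 - s * Y1 * p10 * x1 - s * Y1 * p20 * x2"
    unfolding t11 using nz by (simp add: distrib_left right_diff_distrib)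
  \<comment> \<open>The terms with factor \<open>b\<close> but without \<open>p00\<close> add up to
    \<open>b * t12\<close> by the wave equation.\<close>
  also have "\<dots> = b * t12 - Y1 * (p00 * ((Y + b) / Y * t1 + b / Y * t2 - t / f)
      - t1 / f1 + s * (p10 * x1 + p20 * x2))"
    unfolding t12 by (simp add: algebra_simps)
  finally have "s * (b * t12 - a1 * t11) = s * (Y1 * (p00 * ((Y + b) / Y * t1 + b / Y * t2 - t / f)
      - t1 / f1 + s * (p10 * x1 + p20 * x2)))"
    by simp
  then have "s * (b * t12 - a1 * t11) = Y1 * (p00 * (s * ((Y + b) / Y * t1 + b / Y * t2 - t / f))
      - s * t1 / f1 + (s * s) * (p10 * x1 + p20 * x2))"
    by (simp add: algebra_simps)
  then have c0: "s * (b * t12 - a1 * t11) / Y1 = p00 * (x0 + c) - s * t1 / f1 + p10 * x1 + p20 * x2"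
    unfolding x0c s using nz by simp
  have c1: "y1 = p01 * (x0 + c) + p11 * x1 + p21 * x2"
    unfolding x0c y1 by (simp add: algebra_simps)
  have c2: "y2 = p02 * (x0 + c) + p12 * x1 + p22 * x2"
    unfolding x0c y2 by (simp add: algebra_simps)
  show ?thesis
    unfolding c0 c1 c2 x0_def[symmetric] c_def[symmetric]
    by (simp add: n algebra_simps)
qed

text \<open>With the \<open>n'\<close> term moved to the left, both sides are squared; each then has
  one cross term, whose value is given by \<open>xn\<close>. The squares of the corrections supply
  the terms \<open>Y1 / f1 * t1\<^sup>2\<close> and \<open>Y / f * t\<^sup>2\<close>.\<close>

lemma constraint_shift:
  assumes x': "x' = x + (s * (2 * t1 - t / f)) *\<^sub>R n - (s * t1 / f1) *\<^sub>R n'"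
    and s: "s * s = 1" and nz: "f \<noteq> 0" "f1 \<noteq> 0"
    and Y: "Y = a + b" and Y1: "Y1 = a1 + b" and t12: "t12 = f * t1 + f * t2 - t"
    and n: "form \<epsilon> n n = f * Y" "form \<epsilon> n' n' = f1 * Y1"
    and xn: "form \<epsilon> x n = f * (s * (b * t2 - a * t1))"
      "form \<epsilon> x' n' = f1 * (s * (b * t12 - a1 * t11))"
  shows "form \<epsilon> x' x' + Y1 / f1 * t1\<^sup>2 - 2 * t1 * (a1 * t11 + b * t12)
    = form \<epsilon> x x + Y / f * t\<^sup>2 - 2 * t * (a * t1 + b * t2)"
proof -
  define c d where "c = s * (2 * t1 - t / f)" and "d = s * t1 / f1"
  have "c * c * f = f * (2 * t1 - t / f) * (2 * t1 - t / f)"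
    unfolding c_def using s by algebra
  also have "\<dots> = 4 * f * t1\<^sup>2 - 4 * t * t1 + t\<^sup>2 / f"
    using nz by (simp add: field_simps power2_eq_square)
  finally have c2: "c * c * f = 4 * f * t1\<^sup>2 - 4 * t * t1 + t\<^sup>2 / f" .
  have d2: "d * d * f1 = t1 * t1 / f1"
    using s nz by (simp add: d_def)
  have cf: "s * c * f = 2 * f * t1 - t"
    using s nz by (simp add: c_def mult.assoc[symmetric]) (simp add: algebra_simps)
  have df: "s * d * f1 = t1"
    using s nz by (simp add: d_def mult.assoc[symmetric])
  have "form \<epsilon> (x' + d *\<^sub>R n') (x' + d *\<^sub>R n') = form \<epsilon> (x + c *\<^sub>R n) (x + c *\<^sub>R n)"
    unfolding x' c_def d_def by simp
  then have "form \<epsilon> x' x' + 2 * d * form \<epsilon> x' n' + d * d * form \<epsilon> n' n'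
      = form \<epsilon> x x + 2 * c * form \<epsilon> x n + c * c * form \<epsilon> n n"
    by (simp add: form_commute[of \<epsilon> n x] form_commute[of \<epsilon> n' x'] algebra_simps)
  then have "form \<epsilon> x' x' + 2 * (s * d * f1) * (b * t12 - a1 * t11) + (d * d * f1) * Y1
      = form \<epsilon> x x + 2 * (s * c * f) * (b * t2 - a * t1) + (c * c * f) * Y"
    unfolding n xn by (simp add: algebra_simps)
  then have "form \<epsilon> x' x' + 2 * t1 * (b * t12 - a1 * t11) + Y1 / f1 * t1\<^sup>2
      = form \<epsilon> x x + 2 * (2 * f * t1 - t) * (b * t2 - a * t1)
        + (4 * f * t1\<^sup>2 - 4 * t * t1) * Y + Y / f * t\<^sup>2"
    unfolding cf df c2 d2 by (simp add: algebra_simps power2_eq_square)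
  \<comment> \<open>The left-hand sides differ by \<open>4 * b * t1 * t12\<close>, and so do the
    right-hand sides once \<open>t12\<close> is expanded and \<open>Y = a + b\<close> is
    used.\<close>
  then show ?thesis
    unfolding t12 Y by (simp add: algebra_simps power2_eq_square)
qed

text \<open>The hypotheses are the Moutard relations cleared of denominators, with
  \<open>N12'\<close> reached through \<open>N1'\<close>. That both sums are multiples of one vector
  \<open>B\<close> is the first equation of the system for the transform; the quotient of the two
  factors is the new F.\<close>

lemma moutard_transform_sums:
  fixes N N1 N2 N12 N' N1' N2' N12' :: "'v::real_vector"
  assumes t: "t12 = f * t1 + f * t2 - t" and nz: "t1 \<noteq> 0" "t2 \<noteq> 0" "t12 \<noteq> 0"
    and N: "N12 + N = f *\<^sub>R (N1 + N2)"
    and N1': "t1 *\<^sub>R N1' = t *\<^sub>R N' + s *\<^sub>R (t1 *\<^sub>R N - t *\<^sub>R N1)"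
    and N2': "t2 *\<^sub>R N2' = t *\<^sub>R N' - s *\<^sub>R (t2 *\<^sub>R N - t *\<^sub>R N2)"
    and N12': "t12 *\<^sub>R N12' = t1 *\<^sub>R N1' - s *\<^sub>R (t12 *\<^sub>R N1 - t1 *\<^sub>R N12)"
  defines "B \<equiv> (t1 + t2) *\<^sub>R N' + s *\<^sub>R (t1 *\<^sub>R N2 - t2 *\<^sub>R N1)"
  shows "N12' + N' = (f / t12) *\<^sub>R B" "N1' + N2' = (t / (t1 * t2)) *\<^sub>R B"
proof -
  have N12: "N12 = f *\<^sub>R (N1 + N2) - N"
    using N by (simp add: algebra_simps)
  have "t12 *\<^sub>R (N12' + N') = t1 *\<^sub>R N1' - s *\<^sub>R (t12 *\<^sub>R N1 - t1 *\<^sub>R N12) + t12 *\<^sub>R N'"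
    by (simp add: scaleR_add_right N12')
  also have "\<dots> = f *\<^sub>R B"
    unfolding N1' N12 t B_def by (simp add: algebra_simps)
  finally have "(1 / t12) *\<^sub>R (t12 *\<^sub>R (N12' + N')) = (1 / t12) *\<^sub>R (f *\<^sub>R B)"
    by simp
  then show "N12' + N' = (f / t12) *\<^sub>R B"
    using nz by simp
  have "(t1 * t2) *\<^sub>R (N1' + N2') = t2 *\<^sub>R (t1 *\<^sub>R N1') + t1 *\<^sub>R (t2 *\<^sub>R N2')"
    by (simp add: algebra_simps)
  also have "\<dots> = t *\<^sub>R B"
    unfolding N1' N2' B_def by (simp add: algebra_simps)
  finally have "(1 / (t1 * t2)) *\<^sub>R ((t1 * t2) *\<^sub>R (N1' + N2')) = (1 / (t1 * t2)) *\<^sub>R (t *\<^sub>R B)"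
    by simp
  then show "N1' + N2' = (t / (t1 * t2)) *\<^sub>R B"
    using nz by simp
qed

section \<open>The given solution, its frame, and states of the linear system\<close>

locale bianchi_ernst_frame =
  fixes \<epsilon> s k :: real
    and U V :: "int \<Rightarrow> real"
    and N :: "(real ^ 3) lattice_fun"
    and F :: "real lattice_fun"
    and n :: "3 \<Rightarrow> (real ^ 3) lattice_fun"
    and p q :: "3 \<Rightarrow> 3 \<Rightarrow> real lattice_fun"
  assumes eps: "\<epsilon> \<in> {1, -1}"
    and Y_pos: "\<And>i j. U i + V j > 0"
    and solution: "bianchi_ernst_with \<epsilon> U V N F"
    and n0_def: "\<And>i j. n 0 i j = shift12 N i j + N i j"
    and n00_pos: "\<And>i j. form \<epsilon> (n 0 i j) (n 0 i j) > 0"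
    and n11: "\<And>i j. form \<epsilon> (n 1 i j) (n 1 i j) = \<epsilon>"
    and n22: "\<And>i j. form \<epsilon> (n 2 i j) (n 2 i j) = \<epsilon>"
    and n10: "\<And>i j. form \<epsilon> (n 1 i j) (n 0 i j) = 0"
    and n20: "\<And>i j. form \<epsilon> (n 2 i j) (n 0 i j) = 0"
    and n12: "\<And>i j. form \<epsilon> (n 1 i j) (n 2 i j) = 0"
    and sgn: "s \<in> {1, -1}"
    and a_nz: "\<And>i j. a_of s k U i j \<noteq> 0"
    and b_nz: "\<And>i j. b_of s k V i j \<noteq> 0"
    and p: "\<And>A i j. n A i j = (\<Sum>B\<in>UNIV. p A B i j *\<^sub>R shift1 (n B) i j)"
    and q: "\<And>A i j. n A i j = (\<Sum>B\<in>UNIV. q A B i j *\<^sub>R shift2 (n B) i j)"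
begin

abbreviation Y where "Y i j \<equiv> U i + V j"
abbreviation a where "a i \<equiv> U i - s * k"
abbreviation b where "b j \<equiv> V j + s * k"
text \<open>The matrices act on arbitrary vectors, not only on values of a solution, because
  compatibility is a matrix identity and has to be tested on every state.\<close>

abbreviation step1 where "step1 i j v \<equiv> M1 s k U V F p i j *v v"
abbreviation step2 where "step2 i j v \<equiv> M2 s k U V F q i j *v v"

definition m :: "(real ^ 3) lattice_fun" where
  "m i j = N (i + 1) j + N i (j + 1)"

text \<open>The vector \<open>x\<^sup>A n\<^sub>A\<close> attached to a state \<open>v = (\<Theta>, \<Theta>\<^sub>1, \<Theta>\<^sub>2, x\<^sup>1, x\<^sup>2)\<close>.\<close>

definition X :: "int \<Rightarrow> int \<Rightarrow> real ^ 5 \<Rightarrow> real ^ 3" where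
  "X i j v = (s * (b j * v$3 - a i * v$2) / Y i j) *\<^sub>R n 0 i j + v$4 *\<^sub>R n 1 i j + v$5 *\<^sub>R n 2 i j"

text \<open>The left-hand side of the constraint as a function of the state; the sum of squares of
  x^1, x^2 and the squared difference term are together the square of \<open>X\<close>.\<close>

definition G :: "int \<Rightarrow> int \<Rightarrow> real ^ 5 \<Rightarrow> real" where
  "G i j v = form \<epsilon> (X i j v) (X i j v) + Y i j / F i j * (v$1)\<^sup>2
     - 2 * v$1 * (a i * v$2 + b j * v$3)"

lemma s_s: "s * s = 1"
  using sgn by auto

lemma nz [simp]: "Y i j \<noteq> 0" "a i \<noteq> 0" "b j \<noteq> 0" "\<epsilon> \<noteq> 0" "U i \<noteq> s * k"
  using Y_pos[of i j] a_nz[of i 0] b_nz[of 0 j] eps by (auto simp: a_of_def b_of_def)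

lemma n0_eq: "n 0 i j = F i j *\<^sub>R m i j"
  and n0_N: "n 0 i j = N (i + 1) (j + 1) + N i j"
  and n0_m: "form \<epsilon> (n 0 i j) (m i j) = Y i j"
  using solution
  unfolding bianchi_ernst_with_def n0_def m_def shift1_def shift2_def shift12_def by blast+

lemma n0_n0: "form \<epsilon> (n 0 i j) (n 0 i j) = F i j * Y i j"
  using n0_m[of i j] by (simp add: n0_eq)

lemma F_nz [simp]: "F i j \<noteq> 0"
  using n00_pos[of i j] by (auto simp: n0_n0)

lemma m_m: "form \<epsilon> (m i j) (m i j) = Y i j / F i j"
  using n0_m[of i j] by (simp add: n0_eq field_simps)

lemma X_n0: "form \<epsilon> (X i j v) (n 0 i j) = F i j * (s * (b j * v$3 - a i * v$2))"
  by (simp add: X_def n0_n0 n10 n20)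

lemma X_m: "form \<epsilon> (X i j v) (m i j) = s * (b j * v$3 - a i * v$2)"
  using X_n0[of i j v] by (simp add: n0_eq)

lemma X_n1: "form \<epsilon> (X i j v) (n 1 i j) = \<epsilon> * v$4"
  by (simp add: X_def n11 n10 n12 form_commute[of \<epsilon> "n 0 i j" "n 1 i j"]
      form_commute[of \<epsilon> "n 2 i j" "n 1 i j"])

lemma X_n2: "form \<epsilon> (X i j v) (n 2 i j) = \<epsilon> * v$5"
  by (simp add: X_def n22 n20 n12 form_commute[of \<epsilon> "n 0 i j" "n 2 i j"])

section \<open>The action of the two matrices on states\<close>

lemma step1_nth:
  "step1 i j v $ 1 = v$2"
  "step1 i j v $ 3 = F i j * v$2 + F i j * v$3 - v$1"
  by (simp_all add: M1_def Let_def matrix_vector_mult_def sum_5)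

lemma step2_nth:
  "step2 i j v $ 1 = v$3"
  "step2 i j v $ 2 = F i j * v$2 + F i j * v$3 - v$1"
  by (simp_all add: M2_def Let_def matrix_vector_mult_def sum_5)

text \<open>The frame coefficients \<open>p\<close> drop out here. The rows of \<open>M1\<close>
  that contain them enter the later arguments only through this relation.\<close>

lemma X_step1: "X (i + 1) j (step1 i j v) = X i j v
    + (s * (2 * v$2 - v$1 / F i j)) *\<^sub>R n 0 i j - (s * v$2 / F (i + 1) j) *\<^sub>R n 0 (i + 1) j"
proof -
  have n: "n A i j = p A 0 i j *\<^sub>R n 0 (i + 1) j + p A 1 i j *\<^sub>R n 1 (i + 1) j
      + p A 2 i j *\<^sub>R n 2 (i + 1) j" for A
    by (subst p) (simp add: sum_UNIV_3 shift1_def)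
  show ?thesis
    unfolding X_def
    by (rule frame_shift[OF n n n s_s])
      (simp_all add: step1_nth, simp_all add: M1_def Let_def matrix_vector_mult_def sum_5 Y_of_def
        a_of_def b_of_def shift1_def)
qed

lemma X_step2: "X i (j + 1) (step2 i j v) = X i j v
    - (s * (2 * v$3 - v$1 / F i j)) *\<^sub>R n 0 i j + (s * v$3 / F i (j + 1)) *\<^sub>R n 0 i (j + 1)"
proof -
  have n: "n A i j = q A 0 i j *\<^sub>R n 0 i (j + 1) + q A 1 i j *\<^sub>R n 1 i (j + 1)
      + q A 2 i j *\<^sub>R n 2 i (j + 1)" for A
    by (subst q) (simp add: sum_UNIV_3 shift2_def)
  \<comment> \<open>The claim in the form of \<open>frame_shift\<close> with \<open>- s\<close> for
    \<open>s\<close> and the two directions exchanged.\<close>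
  have "(- s * (a i * step2 i j v $ 2 - b (j + 1) * step2 i j v $ 3) / Y i (j + 1)) *\<^sub>R n 0 i (j + 1)
      + step2 i j v $ 4 *\<^sub>R n 1 i (j + 1) + step2 i j v $ 5 *\<^sub>R n 2 i (j + 1)
    = (- s * (a i * v$2 - b j * v$3) / Y i j) *\<^sub>R n 0 i j + v$4 *\<^sub>R n 1 i j + v$5 *\<^sub>R n 2 i j
      + (- s * (2 * v$3 - v$1 / F i j)) *\<^sub>R n 0 i j - (- s * v$3 / F i (j + 1)) *\<^sub>R n 0 i (j + 1)"
  proof (rule frame_shift[OF n n n])
    show "step2 i j v $ 3 = (Y i (j + 1) * (q 0 0 i j / F i j) - a i) / b (j + 1) * v$1
        + (a i * F i j - Y i (j + 1) * ((Y i j + a i) / Y i j * q 0 0 i j - 1 / F i (j + 1)))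
            / b (j + 1) * v$3
        + a i / b (j + 1) * (F i j - Y i (j + 1) / Y i j * q 0 0 i j) * v$2
        - - s * (Y i (j + 1) / b (j + 1)) * q 1 0 i j * v$4
        - - s * (Y i (j + 1) / b (j + 1)) * q 2 0 i j * v$5"
      by (simp add: M2_def Let_def matrix_vector_mult_def sum_5 Y_of_def a_of_def b_of_def shift2_def)
    show "step2 i j v $ 4 = - (- s) * (q 0 1 i j / F i j) * v$1
        + - s * ((Y i j + a i) / Y i j) * q 0 1 i j * v$3 + - s * (a i / Y i j) * q 0 1 i j * v$2
        + q 1 1 i j * v$4 + q 2 1 i j * v$5"
      "step2 i j v $ 5 = - (- s) * (q 0 2 i j / F i j) * v$1
        + - s * ((Y i j + a i) / Y i j) * q 0 2 i j * v$3 + - s * (a i / Y i j) * q 0 2 i j * v$2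
        + q 1 2 i j * v$4 + q 2 2 i j * v$5"
      by (simp_all add: M2_def Let_def matrix_vector_mult_def sum_5 Y_of_def a_of_def b_of_def add.commute)
  qed (simp_all add: step2_nth s_s)
  moreover have "- s * (a i * y - b j' * z) = s * (b j' * z - a i * y)" for j' y z
    by (simp add: algebra_simps)
  ultimately show ?thesis
    unfolding X_def by (simp only:) simp
qed

lemma G_step1: "G (i + 1) j (step1 i j v) = G i j v"
  unfolding G_def step1_nth(1)
  by (rule constraint_shift[OF X_step1 s_s])
    (simp_all add: step1_nth X_n0 n0_n0)

lemma G_step2: "G i (j + 1) (step2 i j v) = G i j v"
proof -
  have "form \<epsilon> (X i (j + 1) (step2 i j v)) (X i (j + 1) (step2 i j v))
      + Y i (j + 1) / F i (j + 1) * (v$3)\<^sup>2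
      - 2 * v$3 * (b (j + 1) * step2 i j v $ 3 + a i * step2 i j v $ 2)
    = form \<epsilon> (X i j v) (X i j v) + Y i j / F i j * (v$1)\<^sup>2 - 2 * v$1 * (b j * v$3 + a i * v$2)"
  proof (rule constraint_shift)
    \<comment> \<open>As in \<open>X_step2\<close>, the second direction is the first one with
      \<open>- s\<close> for \<open>s\<close> and the roles of \<open>a\<close> and \<open>b\<close>
      exchanged.\<close>
    show "X i (j + 1) (step2 i j v) = X i j v + (- s * (2 * v$3 - v$1 / F i j)) *\<^sub>R n 0 i j
        - (- s * v$3 / F i (j + 1)) *\<^sub>R n 0 i (j + 1)"
      by (simp add: X_step2)
  qed (simp_all add: X_n0 n0_n0 step2_nth s_s, simp_all add: algebra_simps)
  then show ?thesis
    by (simp add: G_def step2_nth add.commute)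
qed

text \<open>Inner products with \<open>n 1\<close>, \<open>n 2\<close> and \<open>m\<close> recover
  these three quantities. Two states with equal \<open>X\<close> therefore coincide once their first
  entries and one of the second and third entries agree.\<close>

lemma X_inject:
  assumes "X i j v = X i j w"
  shows "v$4 = w$4" "v$5 = w$5" "b j * v$3 - a i * v$2 = b j * w$3 - a i * w$2"
proof -
  show "v$4 = w$4" "v$5 = w$5"
    using X_n1[of i j v] X_n1[of i j w] X_n2[of i j v] X_n2[of i j w] assms by simp_all
  have "s * (b j * v$3 - a i * v$2) = s * (b j * w$3 - a i * w$2)"
    by (metis X_m assms)
  then show "b j * v$3 - a i * v$2 = b j * w$3 - a i * w$2"
    using sgn by fastforce
qed

section \<open>Compatibility of the linear system\<close>

lemma m12: "m (i + 1) (j + 1) = n 0 (i + 1) j + n 0 i (j + 1) - m i j"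
  by (simp add: m_def n0_N algebra_simps)

text \<open>Both routes around the square give the same first entry \<open>t12\<close> and the same
  \<open>X\<close>, so by \<open>X_inject\<close> only one scalar equation remains, for the third
  entries.\<close>

lemma step_commute: "step2 (i + 1) j (step1 i j v) = step1 i (j + 1) (step2 i j v)"
proof -
  define w1 w2 where "w1 = step1 i j v" and "w2 = step2 i j v"
  define u1 u2 where "u1 = step2 (i + 1) j w1" and "u2 = step1 i (j + 1) w2"
  define f f1 f2 where "f = F i j" and "f1 = F (i + 1) j" and "f2 = F i (j + 1)"
  define t12 where "t12 = f * v$2 + f * v$3 - v$1"
  define M r1 r2 where "M = m i j" and "r1 = n 0 (i + 1) j" and "r2 = n 0 i (j + 1)"
  have w: "w1$1 = v$2" "w1$3 = t12" "w2$1 = v$3" "w2$2 = t12"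
    by (simp_all add: w1_def w2_def step1_nth step2_nth t12_def f_def)
  have u: "u1$1 = t12" "u1$2 = f1 * w1$2 + f1 * t12 - v$2"
    "u2$1 = t12" "u2$3 = f2 * t12 + f2 * w2$3 - v$3"
    by (simp_all add: u1_def u2_def step1_nth step2_nth w f1_def f2_def)
  have X1: "X (i + 1) j w1 = X i j v + (s * (2 * f * v$2 - v$1)) *\<^sub>R M - (s * v$2) *\<^sub>R m (i + 1) j"
    unfolding w1_def X_step1 by (simp add: n0_eq M_def f_def algebra_simps)
  have X2: "X i (j + 1) w2 = X i j v - (s * (2 * f * v$3 - v$1)) *\<^sub>R M + (s * v$3) *\<^sub>R m i (j + 1)"
    unfolding w2_def X_step2 by (simp add: n0_eq M_def f_def algebra_simps)
  have m1: "(s * v$2) *\<^sub>R m (i + 1) j = (s * v$2 / f1) *\<^sub>R r1"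
    and m2: "(s * v$3) *\<^sub>R m i (j + 1) = (s * v$3 / f2) *\<^sub>R r2"
    by (simp_all add: r1_def r2_def f1_def f2_def n0_eq)
  have m_12: "(s * t12 / F (i + 1) (j + 1)) *\<^sub>R n 0 (i + 1) (j + 1) = (s * t12) *\<^sub>R (r1 + r2 - M)"
    by (simp add: n0_eq m12 r1_def r2_def M_def)
  have c1: "s * (2 * t12 - v$2 / f1) + s * v$2 / f1 = 2 * (s * t12)"
    and c2: "s * (2 * t12 - v$3 / f2) + s * v$3 / f2 = 2 * (s * t12)"
    by (simp_all add: algebra_simps)
  have "X (i + 1) (j + 1) u1 = X i j v + (s * (2 * f * v$2 - v$1)) *\<^sub>R M
      - (s * (2 * t12 - v$2 / f1) + s * v$2 / f1) *\<^sub>R r1 + (s * t12) *\<^sub>R (r1 + r2 - M)"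
    unfolding u1_def X_step2 X1 m1 w m_12 by (simp add: r1_def f1_def algebra_simps)
  also have "\<dots> = X i j v + (s * (f * v$2 - f * v$3)) *\<^sub>R M + (s * t12) *\<^sub>R (r2 - r1)"
    unfolding c1 by (simp add: vec_eq_iff t12_def algebra_simps)
  \<comment> \<open>This value is invariant under exchanging the directions together with
    \<open>s\<close> and \<open>- s\<close>, so the second route must lead to it as well.\<close>
  finally have Xu1: "X (i + 1) (j + 1) u1
      = X i j v + (s * (f * v$2 - f * v$3)) *\<^sub>R M + (s * t12) *\<^sub>R (r2 - r1)" .
  have "X (i + 1) (j + 1) u2 = X i j v - (s * (2 * f * v$3 - v$1)) *\<^sub>R M
      + (s * (2 * t12 - v$3 / f2) + s * v$3 / f2) *\<^sub>R r2 - (s * t12) *\<^sub>R (r1 + r2 - M)"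
    unfolding u2_def X_step1 X2 m2 w m_12 by (simp add: r2_def f2_def algebra_simps)
  also have "\<dots> = X i j v + (s * (f * v$2 - f * v$3)) *\<^sub>R M + (s * t12) *\<^sub>R (r2 - r1)"
    unfolding c2 by (simp add: vec_eq_iff t12_def algebra_simps)
  finally have Xu: "X (i + 1) (j + 1) u1 = X (i + 1) (j + 1) u2"
    using Xu1 by simp
  note inj = X_inject[OF Xu]

  text \<open>Only the first route gives the second entry \<open>\<Theta>\<^sub>1\<^sub>1\<^sub>2\<close> by the wave equation, and only the second
    route gives the third entry \<open>\<Theta>\<^sub>1\<^sub>2\<^sub>2\<close> so; it suffices that these two values match the component
    of \<open>X\<^sub>1\<^sub>2\<close> along \<open>n\<^sub>0\<close>.\<close>

  have r: "form \<epsilon> r1 r1 = f1 * Y (i + 1) j" "form \<epsilon> r2 r2 = f2 * Y i (j + 1)"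
    by (simp_all add: r1_def r2_def f1_def f2_def n0_n0)
  have fMM: "f * form \<epsilon> M M = Y i j"
    by (simp add: M_def f_def m_m)
  \<comment> \<open>\<open>K1\<close> and \<open>K2\<close> express the entries \<open>w1$2\<close>
    and \<open>w2$3\<close>, which depend on the frame coefficients, by inner products
    alone.\<close>
  have K1: "f1 * (s * (b j * t12 - a (i + 1) * w1$2))
      = form \<epsilon> (X i j v) r1 + s * (2 * f * v$2 - v$1) * form \<epsilon> M r1 - s * v$2 * Y (i + 1) j"
    using X_n0[of "i + 1" j w1] n0_m[of "i + 1" j]
    by (simp add: X1 w r1_def f1_def form_commute[of \<epsilon> "m (i + 1) j"])
  have K2: "f2 * (s * (b (j + 1) * w2$3 - a i * t12))
      = form \<epsilon> (X i j v) r2 - s * (2 * f * v$3 - v$1) * form \<epsilon> M r2 + s * v$3 * Y i (j + 1)"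
    using X_n0[of i "j + 1" w2] n0_m[of i "j + 1"]
    by (simp add: X2 w r2_def f2_def form_commute[of \<epsilon> "m i (j + 1)"])
  have XM: "form \<epsilon> (X i j v) M = s * (b j * v$3 - a i * v$2)"
    by (simp add: M_def X_m)
  have "s * (b (j + 1) * u1$3 - a (i + 1) * u1$2)
      = form \<epsilon> (X (i + 1) (j + 1) u1) (m (i + 1) (j + 1))"
    by (simp add: X_m)
  also have "\<dots> = form \<epsilon> (X i j v) r1 + form \<epsilon> (X i j v) r2 - form \<epsilon> (X i j v) M
      + s * (v$2 - v$3) * (f * form \<epsilon> M r1 + f * form \<epsilon> M r2 - f * form \<epsilon> M M)
      + s * t12 * (form \<epsilon> r2 r2 - form \<epsilon> r1 r1 - form \<epsilon> M r2 + form \<epsilon> M r1)"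
    unfolding Xu1 m12 r1_def[symmetric] r2_def[symmetric] M_def[symmetric]
    by (simp add: form_commute[of \<epsilon> r1 M] form_commute[of \<epsilon> r2 M] form_commute[of \<epsilon> r2 r1]
        algebra_simps)
  \<comment> \<open>\<open>u\<close> replaces \<open>u1$2\<close> and \<open>u2$3\<close> by their
    wave-equation values; \<open>K1\<close> and \<open>K2\<close> then eliminate \<open>w1$2\<close>
    and \<open>w2$3\<close>.\<close>
  also have "\<dots> = s * (b (j + 1) * u2$3 - a (i + 1) * u1$2)"
    unfolding XM fMM r u using K1 K2 t12_def by algebra
  finally have "u1$3 = u2$3"
    using sgn nz(3)[of "j + 1"] by auto
  with inj have "u1$2 = u2$2"
    using nz(2)[of "i + 1"] by simp
  then have "u1 = u2"
    using inj \<open>u1$3 = u2$3\<close> u by (simp add: vec_eq_iff_5)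
  then show ?thesis
    by (simp add: u1_def u2_def w1_def w2_def)
qed

lemma compatible: "compatible_system (M1 s k U V F p) (M2 s k U V F q)"
  unfolding compatible_system_def matrix_eq shift1_def shift2_def
  by (simp add: step_commute flip: matrix_vector_mul_assoc)

section \<open>The constraint as a conserved quantity\<close>

lemma constraint_iff:
  "constraint_at \<epsilon> s k U V F \<Theta> x1 x2 i j \<longleftrightarrow> G i j (Psi \<Theta> x1 x2 i j) = 0"
proof -
  \<comment> \<open>This is x^0 without its sign \<open>s\<close>, which disappears on
    squaring.\<close>
  define x where "x = (b j * shift2 \<Theta> i j - a i * shift1 \<Theta> i j) / Y i j"
  have X: "X i j (Psi \<Theta> x1 x2 i j) = (s * x) *\<^sub>R n 0 i j + x1 i j *\<^sub>R n 1 i j + x2 i j *\<^sub>R n 2 i j"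
    by (simp add: X_def Psi_def x_def)
  have "form \<epsilon> (X i j (Psi \<Theta> x1 x2 i j)) (X i j (Psi \<Theta> x1 x2 i j))
      = (s * x) * (s * x) * (F i j * Y i j) + \<epsilon> * ((x1 i j)\<^sup>2 + (x2 i j)\<^sup>2)"
    unfolding X
    by (simp add: n0_n0 n11 n22 n10 n20 n12 form_commute[of \<epsilon> "n 0 i j" "n 1 i j"]
        form_commute[of \<epsilon> "n 0 i j" "n 2 i j"] form_commute[of \<epsilon> "n 2 i j" "n 1 i j"]
        power2_eq_square distrib_left)
  also have "(s * x) * (s * x) = x\<^sup>2"
    using s_s by (metis mult.assoc mult.left_commute mult_1 power2_eq_square)
  finally have "form \<epsilon> (X i j (Psi \<Theta> x1 x2 i j)) (X i j (Psi \<Theta> x1 x2 i j))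
      = x\<^sup>2 * (F i j * Y i j) + \<epsilon> * ((x1 i j)\<^sup>2 + (x2 i j)\<^sup>2)" .
  moreover have "- (a i / Y i j) * shift1 \<Theta> i j + b j / Y i j * shift2 \<Theta> i j = x"
    by (simp add: x_def add_divide_distrib diff_divide_distrib algebra_simps)
  ultimately show ?thesis
    unfolding constraint_at_def G_def Let_def Y_of_def a_of_def b_of_def
    by (simp add: Psi_def algebra_simps)
qed

text \<open>\<open>G\<close> has equal values at neighbouring points. This equality can be read in
  both directions, so a zero at one point spreads over the whole lattice, backwards as well as
  forwards.\<close>

lemma constraint_propagates:
  assumes "solves_linear_system (M1 s k U V F p) (M2 s k U V F q) (Psi \<Theta> x1 x2)"
    and "constraint_at \<epsilon> s k U V F \<Theta> x1 x2 i0 j0"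
  shows "constraint_at \<epsilon> s k U V F \<Theta> x1 x2 i j"
proof -
  define g where "g i j = G i j (Psi \<Theta> x1 x2 i j)" for i j
  have "g (i + 1) j = g i j" "g i (j + 1) = g i j" for i j
    using assms(1) G_step1[of i j] G_step2[of i j]
    by (simp_all add: g_def solves_linear_system_def shift1_def shift2_def)
  then have "g i j = g i0 j" "g i0 j = g i0 j0"
    by (auto intro: int_periodic_1_imp_const[of "\<lambda>i. g i j"] int_periodic_1_imp_const[of "g i0"])
  then show ?thesis
    using assms(2) by (simp add: constraint_iff g_def)
qed

section \<open>The transform of a solution with nowhere vanishing Theta\<close>

context
  fixes \<Theta> x1 x2 :: "real lattice_fun"
  assumes linear: "solves_linear_system (M1 s k U V F p) (M2 s k U V F q) (Psi \<Theta> x1 x2)"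
    and \<Theta>_nz: "\<And>i j. \<Theta> i j \<noteq> 0"
begin

abbreviation N' where "N' \<equiv> transformed s k U V N n \<Theta> x1 x2"
abbreviation X' where "X' i j \<equiv> X i j (Psi \<Theta> x1 x2 i j)"

lemma linear_step:
  "Psi \<Theta> x1 x2 (i + 1) j = step1 i j (Psi \<Theta> x1 x2 i j)"
  "Psi \<Theta> x1 x2 i (j + 1) = step2 i j (Psi \<Theta> x1 x2 i j)"
  using linear by (simp_all add: solves_linear_system_def shift1_def shift2_def)

lemma Psi_nth: "Psi \<Theta> x1 x2 i j $ 1 = \<Theta> i j" "Psi \<Theta> x1 x2 i j $ 2 = \<Theta> (i + 1) j"
  "Psi \<Theta> x1 x2 i j $ 3 = \<Theta> i (j + 1)"
  by (simp_all add: Psi_def shift1_def shift2_def)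

lemma \<Theta>_wave: "\<Theta> (i + 1) (j + 1) = F i j * \<Theta> (i + 1) j + F i j * \<Theta> i (j + 1) - \<Theta> i j"
  using step1_nth(2)[of i j "Psi \<Theta> x1 x2 i j", folded linear_step] by (simp add: Psi_nth)

text \<open>The coefficient of \<open>n 0\<close> in \<open>X\<close> is exactly
  \<open>x0_of\<close>. Clearing the denominator turns the steps of \<open>X\<close> into steps of
  Theta times \<open>N'\<close>.\<close>

lemma transformed_eq:
  "2 *\<^sub>R (\<Theta> i j *\<^sub>R N' i j) = (s * \<Theta> i j) *\<^sub>R (N (i + 1) j - N i (j + 1)) + X' i j"
proof -
  have "X' i j = x0_of s k U V \<Theta> i j *\<^sub>R n 0 i j + x1 i j *\<^sub>R n 1 i j + x2 i j *\<^sub>R n 2 i j"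
    by (simp add: X_def x0_of_def Psi_def algebra_simps)
  then have "N' i j = (1 / 2) *\<^sub>R (s *\<^sub>R N (i + 1) j - s *\<^sub>R N i (j + 1)) + (1 / (2 * \<Theta> i j)) *\<^sub>R X' i j"
    by (simp add: transformed_def shift1_def shift2_def)
  then show ?thesis
    using \<Theta>_nz[of i j] by (simp add: scaleR_add_right scaleR_diff_right mult.commute)
qed

text \<open>The value of \<open>N\<close> two steps away in the first direction cancels between the
  difference in \<open>transformed_eq\<close> and \<open>m (i + 1) j\<close>; the contribution of
  \<open>n 0 i j\<close> then leaves only \<open>N i j\<close>.\<close>

lemma transformed_step1:
  "\<Theta> (i + 1) j *\<^sub>R N' (i + 1) j
    = \<Theta> i j *\<^sub>R N' i j + s *\<^sub>R (\<Theta> (i + 1) j *\<^sub>R N i j - \<Theta> i j *\<^sub>R N (i + 1) j)"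
proof -
  have "X' (i + 1) j = X' i j + (2 * s * \<Theta> (i + 1) j) *\<^sub>R n 0 i j - (s * \<Theta> i j) *\<^sub>R m i j
      - (s * \<Theta> (i + 1) j) *\<^sub>R m (i + 1) j"
    unfolding linear_step X_step1 Psi_nth by (simp add: n0_eq algebra_simps)
  then have "2 *\<^sub>R (\<Theta> (i + 1) j *\<^sub>R N' (i + 1) j) = 2 *\<^sub>R (\<Theta> i j *\<^sub>R N' i j)
      + 2 *\<^sub>R (s *\<^sub>R (\<Theta> (i + 1) j *\<^sub>R N i j - \<Theta> i j *\<^sub>R N (i + 1) j))"
    unfolding transformed_eq by (simp add: n0_N m_def vec_eq_iff algebra_simps)
  then show ?thesis
    unfolding scaleR_add_right[symmetric] by (simp only: scaleR_cancel_left) simp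
qed

lemma transformed_step2:
  "\<Theta> i (j + 1) *\<^sub>R N' i (j + 1)
    = \<Theta> i j *\<^sub>R N' i j - s *\<^sub>R (\<Theta> i (j + 1) *\<^sub>R N i j - \<Theta> i j *\<^sub>R N i (j + 1))"
proof -
  have "X' i (j + 1) = X' i j - (2 * s * \<Theta> i (j + 1)) *\<^sub>R n 0 i j + (s * \<Theta> i j) *\<^sub>R m i j
      + (s * \<Theta> i (j + 1)) *\<^sub>R m i (j + 1)"
    unfolding linear_step X_step2 Psi_nth by (simp add: n0_eq algebra_simps)
  then have "2 *\<^sub>R (\<Theta> i (j + 1) *\<^sub>R N' i (j + 1)) = 2 *\<^sub>R (\<Theta> i j *\<^sub>R N' i j)
      - 2 *\<^sub>R (s *\<^sub>R (\<Theta> i (j + 1) *\<^sub>R N i j - \<Theta> i j *\<^sub>R N i (j + 1)))"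
    unfolding transformed_eq by (simp add: n0_N m_def vec_eq_iff algebra_simps)
  then show ?thesis
    unfolding scaleR_diff_right[symmetric] by (simp only: scaleR_cancel_left) simp
qed

lemma transformed_solution:
  assumes constraint: "\<And>i j. constraint_at \<epsilon> s k U V F \<Theta> x1 x2 i j"
  shows "bianchi_ernst_solution \<epsilon> U V N'"
proof -
  \<comment> \<open>The factor is the quotient of \<open>f / t12\<close> by
    \<open>t / (t1 * t2)\<close> from \<open>moutard_transform_sums\<close>.\<close>
  have "N' (i + 1) (j + 1) + N' i j
      = (F i j * \<Theta> (i + 1) j * \<Theta> i (j + 1) / (\<Theta> i j * \<Theta> (i + 1) (j + 1)))
          *\<^sub>R (N' (i + 1) j + N' i (j + 1))"
    and "form \<epsilon> (N' (i + 1) (j + 1) + N' i j) (N' (i + 1) j + N' i (j + 1)) = Y i j" for i j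
  proof -
    define f t t1 t2 t12 where "f = F i j" and "t = \<Theta> i j" and "t1 = \<Theta> (i + 1) j"
      and "t2 = \<Theta> i (j + 1)" and "t12 = \<Theta> (i + 1) (j + 1)"
    note t_defs = f_def t_def t1_def t2_def t12_def
    have nz: "f \<noteq> 0" "t \<noteq> 0" "t1 \<noteq> 0" "t2 \<noteq> 0" "t12 \<noteq> 0"
      by (simp_all add: t_defs \<Theta>_nz)
    have t12: "t12 = f * t1 + f * t2 - t"
      by (simp add: t_defs \<Theta>_wave)
    define B where "B = (t1 + t2) *\<^sub>R N' i j + s *\<^sub>R (t1 *\<^sub>R N i (j + 1) - t2 *\<^sub>R N (i + 1) j)"
    have N12: "N (i + 1) (j + 1) + N i j = f *\<^sub>R (N (i + 1) j + N i (j + 1))"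
      using n0_N[of i j] by (simp add: n0_eq m_def f_def)
    note sums = moutard_transform_sums[OF t12 nz(3-5) N12
        transformed_step1[of i j, folded t_defs] transformed_step2[of i j, folded t_defs]
        transformed_step2[of "i + 1" j, folded t_defs], folded B_def]
    show "N' (i + 1) (j + 1) + N' i j
        = (F i j * \<Theta> (i + 1) j * \<Theta> i (j + 1) / (\<Theta> i j * \<Theta> (i + 1) (j + 1)))
            *\<^sub>R (N' (i + 1) j + N' i (j + 1))"
      unfolding sums t_defs[symmetric] using nz by simp
    \<comment> \<open>By \<open>sums\<close>, the normalisation amounts to
      \<open>t * f * form \<epsilon> B B = Y i j * t1 * t2 * t12\<close>. A multiple of
      \<open>B\<close> is written in terms of \<open>X'\<close> and \<open>m\<close>, whose inner
      products are all known; the constraint enters through that of \<open>X'\<close> with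
      itself.\<close>
    have "(2 * t) *\<^sub>R B = (t1 + t2) *\<^sub>R (2 *\<^sub>R (t *\<^sub>R N' i j))
        + (2 * t * s) *\<^sub>R (t1 *\<^sub>R N i (j + 1) - t2 *\<^sub>R N (i + 1) j)"
      by (simp add: B_def algebra_simps)
    also have "\<dots> = (t1 + t2) *\<^sub>R X' i j + (s * t * (t1 - t2)) *\<^sub>R m i j"
      unfolding t_def transformed_eq by (simp add: m_def vec_eq_iff algebra_simps)
    finally have B: "(2 * t) *\<^sub>R B = (t1 + t2) *\<^sub>R X' i j + (s * t * (t1 - t2)) *\<^sub>R m i j" .
    have "form \<epsilon> ((2 * t) *\<^sub>R B) ((2 * t) *\<^sub>R B)
        = (t1 + t2)\<^sup>2 * form \<epsilon> (X' i j) (X' i j)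
          + 2 * (s * t * (t1 - t2)) * (t1 + t2) * form \<epsilon> (X' i j) (m i j)
          + (s * t * (t1 - t2))\<^sup>2 * form \<epsilon> (m i j) (m i j)"
      unfolding B by (simp add: form_commute[of \<epsilon> "m i j" "X' i j"] algebra_simps power2_eq_square)
    moreover have "form \<epsilon> (X' i j) (X' i j) = 2 * t * (a i * t1 + b j * t2) - Y i j / f * t\<^sup>2"
      using constraint[of i j] by (simp add: constraint_iff G_def Psi_nth t_defs)
    moreover have "form \<epsilon> (X' i j) (m i j) = s * (b j * t2 - a i * t1)"
      by (simp add: X_m Psi_nth t_defs)
    moreover have "form \<epsilon> (m i j) (m i j) = Y i j / f"
      by (simp add: m_m f_def)
    moreover have "f * (Y i j / f) = Y i j"
      using nz by simp
    ultimately have "4 * t * (t * f * form \<epsilon> B B) = 4 * t * (Y i j * t1 * t2 * t12)"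
      using s_s t12 by (simp only: form_linear) algebra
    then have "t * f * form \<epsilon> B B = Y i j * t1 * t2 * t12"
      using nz by simp
    then show "form \<epsilon> (N' (i + 1) (j + 1) + N' i j) (N' (i + 1) j + N' i (j + 1)) = Y i j"
      unfolding sums using nz by (simp add: field_simps)
  qed
  then show ?thesis
    unfolding bianchi_ernst_solution_def bianchi_ernst_with_def shift1_def shift2_def shift12_def
    by (intro exI[of _ "\<lambda>i j. F i j * \<Theta> (i + 1) j * \<Theta> i (j + 1) / (\<Theta> i j * \<Theta> (i + 1) (j + 1))"])
      simp
qed

end

end

theorem theorem6:
  fixes \<epsilon> s k :: real
    and U V :: "int \<Rightarrow> real"
    and N :: "(real ^ 3) lattice_fun"
    and F :: "real lattice_fun"
    and n :: "3 \<Rightarrow> (real ^ 3) lattice_fun"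
    and p q :: "3 \<Rightarrow> 3 \<Rightarrow> real lattice_fun"
  assumes "\<epsilon> \<in> {1, -1}"
    and "\<And>m1 m2. U m1 + V m2 > 0"
    and "bianchi_ernst_with \<epsilon> U V N F"
    and "\<And>m1 m2. n 0 m1 m2 = shift12 N m1 m2 + N m1 m2"
    and "\<And>m1 m2. form \<epsilon> (n 0 m1 m2) (n 0 m1 m2) > 0"
    and "\<And>m1 m2. form \<epsilon> (n 1 m1 m2) (n 1 m1 m2) = \<epsilon>"
    and "\<And>m1 m2. form \<epsilon> (n 2 m1 m2) (n 2 m1 m2) = \<epsilon>"
    and "\<And>m1 m2. form \<epsilon> (n 1 m1 m2) (n 0 m1 m2) = 0"
    and "\<And>m1 m2. form \<epsilon> (n 2 m1 m2) (n 0 m1 m2) = 0"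
    and "\<And>m1 m2. form \<epsilon> (n 1 m1 m2) (n 2 m1 m2) = 0"
    and "s \<in> {1, -1}"
    and "\<And>m1 m2. a_of s k U m1 m2 \<noteq> 0"
    and "\<And>m1 m2. b_of s k V m1 m2 \<noteq> 0"
    and "\<And>A m1 m2. n A m1 m2 = (\<Sum>B\<in>UNIV. p A B m1 m2 *\<^sub>R shift1 (n B) m1 m2)"
    and "\<And>A m1 m2. n A m1 m2 = (\<Sum>B\<in>UNIV. q A B m1 m2 *\<^sub>R shift2 (n B) m1 m2)"
  shows
    "compatible_system (M1 s k U V F p) (M2 s k U V F q) \<and>
     (\<forall>\<Theta> x1 x2 i0 j0.
        solves_linear_system (M1 s k U V F p) (M2 s k U V F q) (Psi \<Theta> x1 x2) \<longrightarrow>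
        constraint_at \<epsilon> s k U V F \<Theta> x1 x2 i0 j0 \<longrightarrow>
        (\<forall>m1 m2. constraint_at \<epsilon> s k U V F \<Theta> x1 x2 m1 m2)) \<and>
     (\<forall>\<Theta> x1 x2.
        solves_linear_system (M1 s k U V F p) (M2 s k U V F q) (Psi \<Theta> x1 x2) \<longrightarrow>
        (\<forall>m1 m2. \<Theta> m1 m2 \<noteq> 0) \<longrightarrow>
        (\<forall>m1 m2. constraint_at \<epsilon> s k U V F \<Theta> x1 x2 m1 m2) \<longrightarrow>
        bianchi_ernst_solution \<epsilon> U V (transformed s k U V N n \<Theta> x1 x2))"
proof -
  interpret bianchi_ernst_frame \<epsilon> s k U V N F n p q
    by unfold_locales (fact assms)+
  show ?thesis
    using compatible constraint_propagates transformed_solution by blast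
qed

end
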